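(* Let $k\ge 3$ and let $G$ be a $k$-connected graph, and let $p$ be the length of a longest path in $G$. Define $t=\left\lfloor\sqrt{\frac{k-2}{2}}\right\rfloor$ if $p$ is even and $t=\left\lceil\sqrt{\frac{k-2}{2}}\right\rceil$ if $p$ is odd. Then there is a bond of $G$ meeting every path of $G$ of length at least $p-t+1$.
   Context: All graphs are finite, simple and undirected. The length of a path is its number of edges. A bond of $G$ is a minimal nonempty edge-cut, where an edge-cut is a set of edges of the form $\{xy\in E(G): x\in X, y\in V(G)\setminus X\}$ for some $X\subseteq V(G)$. A set of edges meets a path if the path contains at least one edge of the set. *)

theory Defs
  imports Complex_Main
begin

text \<open>A finite simple undirected graph: finite vertex set V, edge set E of
  2-element subsets of V.\<close>
definition simple_graph :: "'a set \<Rightarrow> 'a set set \<Rightarrow> bool" where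
  "simple_graph V E \<longleftrightarrow> finite V \<and> (\<forall>e\<in>E. \<exists>x y. x \<in> V \<and> y \<in> V \<and> x \<noteq> y \<and> e = {x, y})"

text \<open>Connectedness: nonempty and any two vertices joined by a walk.\<close>
definition connected_graph :: "'a set \<Rightarrow> 'a set set \<Rightarrow> bool" where
  "connected_graph V E \<longleftrightarrow> V \<noteq> {} \<and>
     (\<forall>u\<in>V. \<forall>v\<in>V. (u, v) \<in> {(x, y). x \<in> V \<and> y \<in> V \<and> {x, y} \<in> E}\<^sup>*)"

text \<open>The graph G - S.\<close>
definition del_verts_E :: "'a set set \<Rightarrow> 'a set \<Rightarrow> 'a set set" where
  "del_verts_E E S = {e \<in> E. e \<inter> S = {}}"

text \<open>k-connected (Diestel): more than k vertices, and G - S connected whenever |S| < k.\<close>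
definition k_connected :: "nat \<Rightarrow> 'a set \<Rightarrow> 'a set set \<Rightarrow> bool" where
  "k_connected k V E \<longleftrightarrow> card V > k \<and>
     (\<forall>S \<subseteq> V. card S < k \<longrightarrow> connected_graph (V - S) (del_verts_E E S))"

text \<open>A path is a nonempty list of distinct vertices, consecutive ones adjacent.
  Its length is its number of edges.\<close>
definition is_path :: "'a set \<Rightarrow> 'a set set \<Rightarrow> 'a list \<Rightarrow> bool" where
  "is_path V E xs \<longleftrightarrow> xs \<noteq> [] \<and> distinct xs \<and> set xs \<subseteq> V \<and>
     (\<forall>i. Suc i < length xs \<longrightarrow> {xs ! i, xs ! Suc i} \<in> E)"

definition path_length :: "'a list \<Rightarrow> nat" where
  "path_length xs = length xs - 1"

definition path_edges :: "'a list \<Rightarrow> 'a set set" where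
  "path_edges xs = {{xs ! i, xs ! Suc i} | i. Suc i < length xs}"

definition longest_path_length :: "'a set \<Rightarrow> 'a set set \<Rightarrow> nat" where
  "longest_path_length V E = Max (path_length ` {xs. is_path V E xs})"

text \<open>Edge cuts and bonds.\<close>
definition cut_of :: "'a set \<Rightarrow> 'a set set \<Rightarrow> 'a set \<Rightarrow> 'a set set" where
  "cut_of V E X = {e \<in> E. \<exists>x y. e = {x, y} \<and> x \<in> X \<and> y \<in> V - X}"

definition is_edge_cut :: "'a set \<Rightarrow> 'a set set \<Rightarrow> 'a set set \<Rightarrow> bool" where
  "is_edge_cut V E F \<longleftrightarrow> (\<exists>X \<subseteq> V. F = cut_of V E X)"

definition is_bond :: "'a set \<Rightarrow> 'a set set \<Rightarrow> 'a set set \<Rightarrow> bool" where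
  "is_bond V E F \<longleftrightarrow> is_edge_cut V E F \<and> F \<noteq> {} \<and>
     (\<forall>F'. is_edge_cut V E F' \<and> F' \<noteq> {} \<and> F' \<subseteq> F \<longrightarrow> F' = F)"

end

theory Submission
  imports Defs
begin

text \<open>Put \<open>n = max 0 (t - 1)\<close>, so that \<open>2 n\<^sup>2 < k - 2\<close> in both parities, and call a path long if its length
  is at least \<open>p - n\<close>. If no bond meets all long paths, then for every partition of \<open>V\<close> into two
  connected parts one part contains a long path. Take such a part \<open>X\<close> containing a long path \<open>P\<close> with
  \<open>|X|\<close> minimal and move a suitable vertex \<open>v\<close> from \<open>X\<close> to the other part: by minimality the other part
  now contains a long path \<open>Q\<close>, so \<open>P\<close> and \<open>Q\<close> share at most the vertex \<open>v\<close>.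

  Both \<open>P\<close> and \<open>Q\<close> have more than \<open>2 n\<^sup>2 + 1\<close> vertices, as a shorter one could be extended by a
  path into the other that is too long. By Menger's theorem there are \<open>2 n\<^sup>2 + 1\<close> disjoint paths
  from \<open>P\<close> to \<open>Q\<close> in \<open>G - v\<close>. After possibly
  reversing \<open>Q\<close>, more than \<open>n\<^sup>2\<close> of them attach to \<open>P\<close> and \<open>Q\<close> on the same side of \<open>v\<close>. Let such a path
  attach at the positions \<open>i\<close> and \<open>j\<close>. Switching from \<open>P\<close> to \<open>Q\<close> or back along it once gives
  paths too long unless \<open>|i - j| < n\<close>, so there are \<open>n\<close> classes of pairs with \<open>j - i\<close> constant up to one.
  The connections in one class are met in the same order by \<open>P\<close> and \<open>Q\<close>, and switching at each of
  \<open>r\<close> such connections yields two complementary zigzag paths with total length at least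
  \<open>|P| + |Q| + 2 r\<close>, so \<open>r \<le> n\<close>. Hence there are at most \<open>n\<^sup>2\<close> of them, a contradiction.\<close>

subsection \<open>Menger's theorem\<close>

abbreviation walk :: "('a \<times> 'a) set \<Rightarrow> 'a list \<Rightarrow> bool" where
  "walk r \<equiv> successively (\<lambda>x y. (x, y) \<in> r)"

text \<open>One-vertex walks count, so a separator contains \<open>A \<inter> B\<close>. Walks may
  repeat vertices, so a spliced walk can be tested against \<open>S\<close> directly.\<close>

definition separates :: "('a \<times> 'a) set \<Rightarrow> 'a set \<Rightarrow> 'a set \<Rightarrow> 'a set \<Rightarrow> bool" where
  "separates r A B S \<longleftrightarrow>
     (\<forall>R. R \<noteq> [] \<and> walk r R \<and> hd R \<in> A \<and> last R \<in> B \<longrightarrow> set R \<inter> S \<noteq> {})"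

text \<open>An \<open>A\<close>-\<open>B\<close> path in the sense of Menger's theorem; a single
  vertex of \<open>A \<inter> B\<close> is one.\<close>

definition connector :: "('a \<times> 'a) set \<Rightarrow> 'a set \<Rightarrow> 'a set \<Rightarrow> 'a list \<Rightarrow> bool" where
  "connector r A B R \<longleftrightarrow> R \<noteq> [] \<and> walk r R \<and> distinct R \<and>
     set R \<inter> A = {hd R} \<and> set R \<inter> B = {last R}"

definition linked :: "('a \<times> 'a) set \<Rightarrow> 'a set \<Rightarrow> 'a set \<Rightarrow> nat \<Rightarrow> bool" where
  "linked r A B m \<longleftrightarrow> (\<exists>C. finite C \<and> card C = m \<and> (\<forall>R\<in>C. connector r A B R) \<and>
     (\<forall>R\<in>C. \<forall>R'\<in>C. R \<noteq> R' \<longrightarrow> set R \<inter> set R' = {}))"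

lemma walk_mono: "walk r R \<Longrightarrow> r \<subseteq> r' \<Longrightarrow> walk r' R"
  by (erule successively_mono) auto

text \<open>A shortest such walk inside \<open>set R\<close> works: a repeated vertex, a later visit
  to \<open>A\<close> or an earlier visit to \<open>B\<close> would each allow a shortcut.\<close>

lemma walk_shorten:
  assumes "R \<noteq> []" "walk r R" "hd R \<in> A" "last R \<in> B"
  obtains R' where "connector r A B R'" "set R' \<subseteq> set R"
proof -
  let ?P = "\<lambda>R'. R' \<noteq> [] \<and> walk r R' \<and> hd R' \<in> A \<and> last R' \<in> B \<and> set R' \<subseteq> set R"
  define R' where "R' = arg_min length ?P"
  have R': "?P R'" and "\<And>T. ?P T \<Longrightarrow> length R' \<le> length T"
    using arg_min_nat_lemma[of ?P R length] assms unfolding R'_def by auto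
  then have min: "\<And>T. length T < length R' \<Longrightarrow> \<not> ?P T" by fastforce
  have "distinct R'"
  proof (rule ccontr)
    assume "\<not> distinct R'"
    then obtain xs ys zs y where eq: "R' = xs @ [y] @ ys @ [y] @ zs"
      using not_distinct_decomp by blast
    have "?P (xs @ [y] @ zs)" using R' unfolding eq
      by (cases xs; cases zs) (auto simp: successively_append_iff successively_Cons hd_append)
    then show False using min[of "xs @ [y] @ zs"] eq by simp
  qed
  moreover have "set R' \<inter> A = {hd R'}"
  proof -
    have "y = hd R'" if "y \<in> set R'" "y \<in> A" for y
    proof (rule ccontr)
      assume ne: "y \<noteq> hd R'"
      from that obtain xs ys where eq: "R' = xs @ y # ys" by (meson split_list)
      with ne have "xs \<noteq> []" by auto
      have "?P (y # ys)" using R' that unfolding eq by (auto simp: successively_append_iff)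
      then show False using min[of "y # ys"] eq \<open>xs \<noteq> []\<close> by simp
    qed
    then show ?thesis using R' by auto
  qed
  moreover have "set R' \<inter> B = {last R'}"
  proof -
    have "y = last R'" if "y \<in> set R'" "y \<in> B" for y
    proof (rule ccontr)
      assume ne: "y \<noteq> last R'"
      from that obtain xs ys where eq: "R' = xs @ y # ys" by (meson split_list)
      with ne have "ys \<noteq> []" by auto
      have "walk r (xs @ [y])" using R' unfolding eq by (auto simp: successively_append_iff)
      then have "?P (xs @ [y])" using R' that unfolding eq by (cases xs) auto
      then show False using min[of "xs @ [y]"] eq \<open>ys \<noteq> []\<close> by simp
    qed
    then show ?thesis using R' by auto
  qed
  ultimately show thesis using that R' unfolding connector_def by blast
qed

text \<open>Trimming each \<open>h s\<close> within its own vertices keeps the family disjoint, so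
  the given walks may repeat vertices or revisit \<open>A\<close> and \<open>B\<close>. Disjoint
  nonempty lists differ, which preserves the count.\<close>

lemma linkedI:
  assumes "finite I"
    and h: "\<And>s. s \<in> I \<Longrightarrow> h s \<noteq> [] \<and> walk r (h s) \<and> hd (h s) \<in> A \<and> last (h s) \<in> B"
    and disj: "\<And>s s'. s \<in> I \<Longrightarrow> s' \<in> I \<Longrightarrow> s \<noteq> s' \<Longrightarrow> set (h s) \<inter> set (h s') = {}"
  shows "linked r A B (card I)"
proof -
  have "\<forall>s\<in>I. \<exists>R'. connector r A B R' \<and> set R' \<subseteq> set (h s)"
  proof
    fix s assume "s \<in> I"
    then obtain R' where "connector r A B R'" "set R' \<subseteq> set (h s)"
      using walk_shorten[of "h s" r A B] h by blast
    then show "\<exists>R'. connector r A B R' \<and> set R' \<subseteq> set (h s)" by blast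
  qed
  then obtain g where g: "\<And>s. s \<in> I \<Longrightarrow> connector r A B (g s) \<and> set (g s) \<subseteq> set (h s)"
    by metis
  have ne: "g s \<noteq> []" if "s \<in> I" for s using g[OF that] by (auto simp: connector_def)
  have disj': "set (g s) \<inter> set (g s') = {}" if "s \<in> I" "s' \<in> I" "s \<noteq> s'" for s s'
    using g[OF that(1)] g[OF that(2)] disj[OF that] by blast
  have "inj_on g I"
  proof (rule inj_onI, rule ccontr)
    fix s s' assume "s \<in> I" "s' \<in> I" "g s = g s'" "s \<noteq> s'"
    then show False using disj'[of s s'] ne[of s] by simp
  qed
  then show ?thesis unfolding linked_def
    by (intro exI[of _ "g ` I"]) (use \<open>finite I\<close> g disj' in \<open>auto simp: card_image, blast+\<close>)
qed

lemma linked_mono: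
  assumes "linked r A B m" "r \<subseteq> r'" shows "linked r' A B m"
proof -
  have "connector r' A B R" if "connector r A B R" for R
    using that walk_mono[OF _ \<open>r \<subseteq> r'\<close>] unfolding connector_def by blast
  then show ?thesis using assms(1) unfolding linked_def by blast
qed

lemma walk_insert_cases:
  assumes "walk (insert (x, y) r) R"
  shows "walk r R \<or> (x \<in> set R \<and> y \<in> set R)"
  using assms
proof (induction R)
  case (Cons a R)
  then show ?case by (cases R) auto
qed auto

text \<open>The new arc can only be taken on leaving \<open>x\<close>, and \<open>x\<close> can
  occur here only as the last vertex.\<close>

lemma walk_insert_last:
  assumes "walk (insert (x, y) r) (xs @ [z])" "x \<notin> set xs"
  shows "walk r (xs @ [z])"
  using assms
proof (induction xs)
  case (Cons a xs)
  then show ?case by (cases xs) auto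
qed auto

lemma walk_insert_hd:
  assumes "walk (insert (x, y) r) (z # xs)" "y \<notin> set xs"
  shows "walk r (z # xs)"
  using assms
proof (induction xs arbitrary: z)
  case (Cons a xs)
  then show ?case by auto
qed auto

text \<open>As many disjoint paths as \<open>T\<close> has vertices end bijectively in
  \<open>T\<close>; indexing them by their ends prepares for gluing at a separator.\<close>

lemma linked_family:
  assumes "linked r A T (card T)" "finite T"
  obtains f where "\<And>s. s \<in> T \<Longrightarrow> connector r A T (f s) \<and> last (f s) = s"
    and "\<And>s s'. s \<in> T \<Longrightarrow> s' \<in> T \<Longrightarrow> s \<noteq> s' \<Longrightarrow> set (f s) \<inter> set (f s') = {}"
proof -
  obtain C where C: "finite C" "card C = card T" "\<And>R. R \<in> C \<Longrightarrow> connector r A T R"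
    "\<And>R R'. R \<in> C \<Longrightarrow> R' \<in> C \<Longrightarrow> R \<noteq> R' \<Longrightarrow> set R \<inter> set R' = {}"
    using assms(1) unfolding linked_def by auto
  have "inj_on last C"
  proof (rule inj_onI, rule ccontr)
    fix R R' assume "R \<in> C" "R' \<in> C" "last R = last R'" "R \<noteq> R'"
    then show False using C(4)[of R R'] C(3)[of R] C(3)[of R']
      unfolding connector_def by (metis disjoint_iff last_in_set)
  qed
  then have "last ` C = T"
    using C \<open>finite T\<close> by (intro card_subset_eq) (auto simp: card_image connector_def)
  then have "\<forall>s\<in>T. \<exists>R\<in>C. last R = s" by auto
  then obtain f where f: "\<And>s. s \<in> T \<Longrightarrow> f s \<in> C \<and> last (f s) = s" by metis
  show thesis by (rule that[of f]) (use C f in metis)+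
qed

text \<open>The relation is directed; reversal lets \<open>linked_family\<close> index paths that
  start in a separator.\<close>

lemma linked_converse:
  assumes "linked r A B m" shows "linked (r\<inverse>) B A m"
proof -
  obtain C where C: "finite C" "card C = m" "\<And>R. R \<in> C \<Longrightarrow> connector r A B R"
    "\<And>R R'. R \<in> C \<Longrightarrow> R' \<in> C \<Longrightarrow> R \<noteq> R' \<Longrightarrow> set R \<inter> set R' = {}"
    using assms(1) unfolding linked_def by auto
  have "connector (r\<inverse>) B A (rev R)" if "R \<in> C" for R
    using C(3)[OF that] by (auto simp: connector_def hd_rev last_rev)
  then show ?thesis unfolding linked_def
    by (intro exI[of _ "rev ` C"]) (use C in \<open>auto simp: card_image\<close>)
qed

text \<open>Goering's induction: if deleting the edge \<open>(x, y)\<close> creates a separator \<open>S\<close> with fewer than \<open>m\<close>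
  vertices, then \<open>S \<union> {x}\<close> and \<open>S \<union> {y}\<close> have exactly \<open>m\<close> vertices, and the paths from \<open>A\<close> to
  \<open>S \<union> {x}\<close> and from \<open>S \<union> {y}\<close> to \<open>B\<close> given by the induction hypothesis meet only in \<open>S\<close>.\<close>

lemma menger:
  assumes "finite r" "finite A" "finite B"
    and "\<And>S. finite S \<Longrightarrow> separates r A B S \<Longrightarrow> m \<le> card S"
  shows "linked r A B m"
  using assms
proof (induction r arbitrary: A B m rule: finite_induct)
  case empty
  have "separates {} A B (A \<inter> B)"
    unfolding separates_def
  proof (intro allI impI)
    fix R :: "'a list" assume R: "R \<noteq> [] \<and> walk {} R \<and> hd R \<in> A \<and> last R \<in> B"
    then have "R = [hd R]" by (cases R rule: remdups_adj.cases) auto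
    with R show "set R \<inter> (A \<inter> B) \<noteq> {}" by (metis IntI empty_iff hd_in_set last.simps)
  qed
  then have "m \<le> card (A \<inter> B)" using empty by blast
  then obtain I where I: "I \<subseteq> A \<inter> B" "finite I" "card I = m"
    by (meson obtain_subset_with_card_n)
  have "linked {} A B (card I)"
    by (rule linkedI[where h = "\<lambda>s. [s]"]) (use I in auto)
  then show ?case using I by simp
next
  case (insert e r)
  obtain x y where e: "e = (x, y)" by (cases e)
  show ?case
  proof (cases "\<forall>S. finite S \<longrightarrow> separates r A B S \<longrightarrow> m \<le> card S")
    case True
    then have "linked r A B m" using insert by blast
    then show ?thesis by (rule linked_mono) auto
  next
    case False
    then obtain S where S: "finite S" "separates r A B S" "card S < m" by auto
    have sep: "separates (insert e r) A B (insert z S)" if "z = x \<or> z = y" for z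
      unfolding separates_def
    proof (intro allI impI)
      fix R assume R: "R \<noteq> [] \<and> walk (insert e r) R \<and> hd R \<in> A \<and> last R \<in> B"
      show "set R \<inter> insert z S \<noteq> {}"
        using walk_insert_cases[of x y r R] R S(2) that unfolding e separates_def by blast
    qed
    have ge: "m \<le> card (insert x S)" "m \<le> card (insert y S)"
      using sep insert.prems(3) S(1) by auto
    with S have xS: "x \<notin> S" "y \<notin> S" "card (insert x S) = m" "card (insert y S) = m"
      by (auto simp: card_insert_if split: if_splits)
    have "linked r A (insert x S) m"
    proof (rule insert.IH)
      fix S' assume S': "finite S'" "separates r A (insert x S) S'"
      \<comment> \<open>Let a walk from \<open>A\<close> to \<open>B\<close> first meet
        \<open>insert x S\<close> at \<open>u\<close>. Up to there it has not left \<open>x\<close>,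
        so this piece is a walk in \<open>r\<close> and meets \<open>S'\<close>.\<close>
      have "separates (insert e r) A B S'"
        unfolding separates_def
      proof (intro allI impI)
        fix R assume R: "R \<noteq> [] \<and> walk (insert e r) R \<and> hd R \<in> A \<and> last R \<in> B"
        then have "\<exists>u\<in>set R. u \<in> insert x S" using sep[of x] by (auto simp: separates_def)
        then obtain xs u ys where eq: "R = xs @ u # ys" "u \<in> insert x S"
          "\<forall>z\<in>set xs. z \<notin> insert x S"
          using split_list_first_prop[of R "\<lambda>z. z \<in> insert x S"] by blast
        have "walk r (xs @ [u])"
          by (rule walk_insert_last[of x y])
            (use R eq e in \<open>auto simp: successively_append_iff\<close>)
        moreover have "hd (xs @ [u]) \<in> A" using R eq by (cases xs) auto
        ultimately show "set R \<inter> S' \<noteq> {}"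
          using S'(2)[unfolded separates_def, rule_format, of "xs @ [u]"] eq by auto
      qed
      then show "m \<le> card S'" using insert.prems S' by blast
    qed (use insert S in auto)
    then obtain f where f: "\<And>s. s \<in> insert x S \<Longrightarrow> connector r A (insert x S) (f s) \<and> last (f s) = s"
      and fd: "\<And>s s'. s \<in> insert x S \<Longrightarrow> s' \<in> insert x S \<Longrightarrow> s \<noteq> s' \<Longrightarrow> set (f s) \<inter> set (f s') = {}"
      using linked_family[of r A "insert x S"] xS S by auto
    have "linked r (insert y S) B m"
    proof (rule insert.IH)
      fix S' assume S': "finite S'" "separates r (insert y S) B S'"
      have "separates (insert e r) A B S'"
        unfolding separates_def
      proof (intro allI impI)
        fix R assume R: "R \<noteq> [] \<and> walk (insert e r) R \<and> hd R \<in> A \<and> last R \<in> B"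
        then have "\<exists>u\<in>set R. u \<in> insert y S" using sep[of y] by (auto simp: separates_def)
        then obtain xs u ys where eq: "R = xs @ u # ys" "u \<in> insert y S"
          "\<forall>z\<in>set ys. z \<notin> insert y S"
          using split_list_last_prop[of R "\<lambda>z. z \<in> insert y S"] by blast
        have "walk r (u # ys)"
          by (rule walk_insert_hd[of x y])
            (use R eq e in \<open>auto simp: successively_append_iff\<close>)
        then show "set R \<inter> S' \<noteq> {}"
          using S'(2)[unfolded separates_def, rule_format, of "u # ys"] eq R by auto
      qed
      then show "m \<le> card S'" using insert.prems S' by blast
    qed (use insert S in auto)
    then obtain g' where g': "\<And>s. s \<in> insert y S \<Longrightarrow> connector (r\<inverse>) B (insert y S) (g' s) \<and> last (g' s) = s"
      and gd': "\<And>s s'. s \<in> insert y S \<Longrightarrow> s' \<in> insert y S \<Longrightarrow> s \<noteq> s' \<Longrightarrow> set (g' s) \<inter> set (g' s') = {}"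
      using linked_family[of "r\<inverse>" B "insert y S"] linked_converse[of r "insert y S" B m] xS S by auto
    define g where "g s = rev (g' s)" for s
    have g: "connector r (insert y S) B (g s) \<and> hd (g s) = s" if "s \<in> insert y S" for s
      using g'[OF that] by (auto simp: connector_def hd_rev last_rev g_def)
    have gd: "set (g s) \<inter> set (g s') = {}" if "s \<in> insert y S" "s' \<in> insert y S" "s \<noteq> s'" for s s'
      using gd'[OF that] by (simp add: g_def)
    \<comment> \<open>At a common vertex \<open>z\<close> the two paths splice to a walk in
      \<open>r\<close> from \<open>A\<close> to \<open>B\<close>, which must hit \<open>S\<close>.
      As \<open>f s\<close> meets \<open>S\<close> at most at its end and \<open>g s'\<close> at
      most at its start, the hit is \<open>z\<close> itself.\<close>
    have fg: "s = s' \<and> s \<in> S" if s: "s \<in> insert x S" "s' \<in> insert y S"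
      and z: "z \<in> set (f s)" "z \<in> set (g s')" for s s' z
    proof -
      obtain xs ys where fs: "f s = xs @ z # ys" using z by (meson split_list)
      obtain us vs where gs: "g s' = us @ z # vs" using z by (meson split_list)
      have F: "walk r (xs @ z # ys)" "hd (xs @ z # ys) \<in> A" "distinct (xs @ z # ys)"
        using f[OF s(1)] unfolding connector_def fs by auto
      have G: "walk r (us @ z # vs)" "last (us @ z # vs) \<in> B" "distinct (us @ z # vs)"
        using g[OF s(2)] unfolding connector_def gs by auto
      have "walk r (xs @ z # vs)" using F(1) G(1) by (simp add: successively_append_iff)
      moreover have "hd (xs @ z # vs) \<in> A" using F(2) by (cases xs) simp_all
      moreover have "last (xs @ z # vs) \<in> B" using G(2) by (simp split: if_splits)
      ultimately obtain u where u: "u \<in> S" "u \<in> set (xs @ z # vs)"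
        using S(2) unfolding separates_def by blast
      have "z \<in> S"
      proof (cases "u \<in> set (xs @ [z])")
        case True
        then have "u = last (f s)" using f[OF s(1)] u unfolding connector_def fs by auto
        have "ys = []"
        proof (rule ccontr)
          assume "ys \<noteq> []"
          then have "u \<in> set ys" using \<open>u = last (f s)\<close> fs by simp
          then show False using True F(3) by auto
        qed
        then show ?thesis using u \<open>u = last (f s)\<close> fs by simp
      next
        case False
        then have "u \<in> set vs" using u by auto
        moreover then have "u = hd (g s')" using g[OF s(2)] u unfolding connector_def gs by auto
        ultimately have False using g[OF s(2)] unfolding connector_def gs by (cases us) auto
        then show ?thesis ..
      qed
      have "z \<in> set (f s) \<inter> insert x S" "z \<in> set (g s') \<inter> insert y S" using \<open>z \<in> S\<close> z by auto
      then have "z = s" "z = s'" using f[OF s(1)] g[OF s(2)] unfolding connector_def by auto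
      then show ?thesis using \<open>z \<in> S\<close> by simp
    qed
    \<comment> \<open>\<open>f x\<close> and \<open>g y\<close> are joined by the arc
      \<open>(x, y)\<close>. Every other pair shares its vertex \<open>s\<close> of
      \<open>S\<close>, whose second copy \<open>tl\<close> removes.\<close>
    define h where "h s = (if s = x then f x @ g y else f s @ tl (g s))" for s
    define t where "t s = (if s = x then y else s)" for s
    have t: "t s \<in> insert y S" if "s \<in> insert x S" for s using that by (auto simp: t_def)
    have hs: "set (h s) \<subseteq> set (f s) \<union> set (g (t s))" for s
      by (cases "g s") (auto simp: h_def t_def)
    have "linked (insert e r) A B (card (insert x S))"
    proof (rule linkedI[where h = h])
      fix s assume s: "s \<in> insert x S"
      have w: "walk (insert e r) (f s)" "walk (insert e r) (g (t s))"
        using f[OF s] g[OF t[OF s]] walk_mono[of r _ "insert e r"] unfolding connector_def by auto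
      have f': "f s \<noteq> []" "hd (f s) \<in> A" "last (f s) = s"
        using f[OF s] unfolding connector_def by auto
      have g': "g (t s) \<noteq> []" "last (g (t s)) \<in> B" "hd (g (t s)) = t s"
        using g[OF t[OF s]] unfolding connector_def by auto
      show "h s \<noteq> [] \<and> walk (insert e r) (h s) \<and> hd (h s) \<in> A \<and> last (h s) \<in> B"
      proof (cases "s = x")
        case True
        then show ?thesis using w f' g' by (auto simp: h_def t_def successively_append_iff e)
      next
        case False
        then obtain vs where vs: "g s = s # vs" using g' by (cases "g s") (auto simp: t_def)
        then show ?thesis using w f' g' False
          by (auto simp: h_def t_def successively_append_iff successively_Cons last_append)
      qed
    next
      fix s s' assume s: "s \<in> insert x S" "s' \<in> insert x S" "s \<noteq> s'"
      have tt: "t s \<noteq> t s'" using s xS by (auto simp: t_def split: if_splits)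
      have ne: "\<not> (s = t s' \<and> s \<in> S)" "\<not> (s' = t s \<and> s' \<in> S)"
        using s xS by (auto simp: t_def)
      have "set (f s) \<inter> set (g (t s')) = {}" "set (f s') \<inter> set (g (t s)) = {}"
        using fg[OF s(1) t[OF s(2)]] fg[OF s(2) t[OF s(1)]] ne by blast+
      then show "set (h s) \<inter> set (h s') = {}"
        using hs[of s] hs[of s'] fd[OF s] gd[OF t[OF s(1)] t[OF s(2)] tt] by blast
    qed (use S in auto)
    then show ?thesis using xS by simp
  qed
qed

subsection \<open>Zigzags between two paths\<close>

lemma successively_switch:
  assumes "successively p (xs @ hd R # ys)" "successively p R" "R \<noteq> []"
    and "successively p (zs @ last R # ws)"
  shows "successively p (xs @ R @ ws)"
  using assms by (auto simp: successively_append_iff successively_Cons)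

text \<open>Rails \<open>P\<close> and \<open>Q\<close> with rungs \<open>C\<close> attached at
  positions \<open>i\<close> and \<open>j\<close>. The rails may intersect; \<open>compat\<close>
  places each common vertex before a given rung on both rails or behind it on both, so changing
  rails along the rung never visits it twice.\<close>

locale ladder =
  fixes adj :: "'a \<Rightarrow> 'a \<Rightarrow> bool" and P Q :: "'a list" and C :: "'a list set"
    and i j :: "'a list \<Rightarrow> nat"
  assumes sym: "adj x y \<Longrightarrow> adj y x"
    and P: "successively adj P" "distinct P"
    and Q: "successively adj Q" "distinct Q"
    and R: "R \<in> C \<Longrightarrow> R \<noteq> [] \<and> successively adj R \<and> distinct R"
    and iR: "R \<in> C \<Longrightarrow> i R < length P \<and> hd R = P ! i R \<and> set R \<inter> set P = {hd R}"
    and jR: "R \<in> C \<Longrightarrow> j R < length Q \<and> last R = Q ! j R \<and> set R \<inter> set Q = {last R}"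
    and disj: "R \<in> C \<Longrightarrow> R' \<in> C \<Longrightarrow> R \<noteq> R' \<Longrightarrow> set R \<inter> set R' = {}"
    and compat: "R \<in> C \<Longrightarrow> a < length P \<Longrightarrow> b < length Q \<Longrightarrow> P ! a = Q ! b \<Longrightarrow>
      i R < a \<and> j R < b \<or> a < i R \<and> b < j R"
begin

text \<open>A one-vertex rung would be a common vertex of the rails at its own attachment positions,
  against \<open>compat\<close>.\<close>

lemma rung_length:
  assumes "R \<in> C" shows "2 \<le> length R"
proof -
  have "P ! i R \<noteq> Q ! j R"
    using compat[OF assms, of "i R" "j R"] iR[OF assms] jR[OF assms] by auto
  then have "hd R \<noteq> last R" using iR[OF assms] jR[OF assms] by simp
  then show ?thesis using R[OF assms] by (cases R rule: remdups_adj.cases) auto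
qed

lemma adj_rev: "successively adj (rev xs) = successively adj xs"
proof -
  have "(\<lambda>x y. adj y x) = adj" using sym by blast
  then show ?thesis by (simp only: successively_rev)
qed

text \<open>These are the pieces brought together by a change of rails at \<open>R\<close>. The
  mixed pairs rest on \<open>compat\<close>: a common vertex before \<open>R\<close> on one rail is
  before it on the other.\<close>

lemma segments_disjoint:
  assumes "R \<in> C"
  shows "set (take (i R) P) \<inter> set (drop (Suc (i R)) P) = {}"
    and "set (take (j R) Q) \<inter> set (drop (Suc (j R)) Q) = {}"
    and "set (take (i R) P) \<inter> set (drop (Suc (j R)) Q) = {}"
    and "set (take (j R) Q) \<inter> set (drop (Suc (i R)) P) = {}"
    and "set R \<inter> (set (take (i R) P) \<union> set (drop (Suc (i R)) P)) = {}"
    and "set R \<inter> (set (take (j R) Q) \<union> set (drop (Suc (j R)) Q)) = {}"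
proof -
  note 1 = iR[OF assms] and 2 = jR[OF assms]
  have dP: "P = take (i R) P @ P ! i R # drop (Suc (i R)) P"
    using 1 by (simp add: id_take_nth_drop)
  have dQ: "Q = take (j R) Q @ Q ! j R # drop (Suc (j R)) Q"
    using 2 by (simp add: id_take_nth_drop)
  show "set (take (i R) P) \<inter> set (drop (Suc (i R)) P) = {}"
    using P(2) by (simp add: set_take_disj_set_drop_if_distinct)
  show "set (take (j R) Q) \<inter> set (drop (Suc (j R)) Q) = {}"
    using Q(2) by (simp add: set_take_disj_set_drop_if_distinct)
  show "set (take (i R) P) \<inter> set (drop (Suc (j R)) Q) = {}"
  proof (rule ccontr)
    assume "\<not> ?thesis"
    then obtain a b where "a < i R" "b < length Q - Suc (j R)" "P ! a = Q ! (Suc (j R) + b)"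
      using 1 2 by (auto simp: in_set_conv_nth) metis
    moreover from this have "a < length P" "Suc (j R) + b < length Q" using 1 by linarith+
    ultimately show False using compat[OF assms, of a "Suc (j R) + b"] by linarith
  qed
  show "set (take (j R) Q) \<inter> set (drop (Suc (i R)) P) = {}"
  proof (rule ccontr)
    assume "\<not> ?thesis"
    then obtain a b where "a < j R" "b < length P - Suc (i R)" "P ! (Suc (i R) + b) = Q ! a"
      using 1 2 by (auto simp: in_set_conv_nth) metis
    moreover from this have "a < length Q" "Suc (i R) + b < length P" using 2 by linarith+
    ultimately show False using compat[OF assms, of "Suc (i R) + b" a] by linarith
  qed
  have memP: "x = hd R" if "x \<in> set R" "x \<in> set P" for x
    using 1 that by auto
  have "hd R \<notin> set (take (i R) P) \<union> set (drop (Suc (i R)) P)"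
    using P(2) 1 by (subst (asm) dP) auto
  then show "set R \<inter> (set (take (i R) P) \<union> set (drop (Suc (i R)) P)) = {}"
    using memP set_take_subset[of "i R" P] set_drop_subset[of "Suc (i R)" P] by blast
  have memQ: "x = last R" if "x \<in> set R" "x \<in> set Q" for x
    using 2 that by auto
  have "last R \<notin> set (take (j R) Q) \<union> set (drop (Suc (j R)) Q)"
    using Q(2) 2 by (subst (asm) dQ) auto
  then show "set R \<inter> (set (take (j R) Q) \<union> set (drop (Suc (j R)) Q)) = {}"
    using memQ set_take_subset[of "j R" Q] set_drop_subset[of "Suc (j R)" Q] by blast
qed

lemma drop_split:
  assumes "n < length xs" "a \<le> n"
  shows "drop a xs = drop a (take n xs) @ xs ! n # drop (Suc n) xs"
proof -
  have "drop a xs = drop a (take n xs @ xs ! n # drop (Suc n) xs)"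
    using assms by (simp add: id_take_nth_drop[symmetric])
  then show ?thesis using assms by simp
qed

text \<open>At every rung both walks change sides, so together they use each segment of the two
  rails once and every rung twice.\<close>

lemma zigzag:
  assumes "finite D" "D \<subseteq> C"
    and chain: "\<And>R R'. R \<in> D \<Longrightarrow> R' \<in> D \<Longrightarrow> i R < i R' \<Longrightarrow> j R < j R'"
    and "\<And>R. R \<in> D \<Longrightarrow> a \<le> i R \<and> b \<le> j R"
    and "successively adj (us @ drop a P)" "successively adj (ws @ drop b Q)"
  shows "\<exists>A B. successively adj (us @ A) \<and> successively adj (ws @ B) \<and> distinct A \<and> distinct B \<and>
    set A \<union> set B \<subseteq> set (drop a P) \<union> set (drop b Q) \<union> (\<Union>R\<in>D. set R) \<and>
    length (drop a P) + length (drop b Q) + 2 * card D \<le> length A + length B"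
  using assms
\<comment> \<open>The prefixes \<open>us\<close> and \<open>ws\<close> carry only adjacency at the
  joints. That \<open>A\<close> and \<open>B\<close> avoid what was traversed before comes from the
  bound on their vertices.\<close>
proof (induction "card D" arbitrary: D a b us ws)
  case 0
  then show ?case by (intro exI[of _ "drop a P"] exI[of _ "drop b Q"]) (use P Q in auto)
next
  case (Suc d)
  have "D \<noteq> {}" using Suc.hyps by auto
  then obtain R where RD: "R \<in> D" and Rmin: "\<And>R'. R' \<in> D \<Longrightarrow> i R \<le> i R'"
    using ex_min_if_finite[of "i ` D"] \<open>finite D\<close> by (auto, meson not_less)
  have RC: "R \<in> C" using RD Suc.prems by auto
  define D' where "D' = D - {R}"
  have D': "D' \<subseteq> C" "finite D'" "card D' = d" and D: "D = insert R D'" "card D = Suc (card D')"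
    using Suc.prems Suc.hyps RD by (auto simp: D'_def)
  note 1 = iR[OF RC] and 2 = jR[OF RC] and 3 = R[OF RC]
  have ab: "a \<le> i R" "b \<le> j R" using Suc.prems RD by auto
  define P1 Q1 where "P1 = drop a (take (i R) P)" and "Q1 = drop b (take (j R) Q)"
  define P2 Q2 where "P2 = drop (Suc (i R)) P" and "Q2 = drop (Suc (j R)) Q"
  have dP: "drop a P = P1 @ hd R # P2" and dQ: "drop b Q = Q1 @ last R # Q2"
    unfolding P1_def P2_def Q1_def Q2_def using drop_split 1 2 ab by auto
  \<comment> \<open>Disjoint rungs have different heads, so \<open>R\<close> comes strictly first on
    \<open>P\<close>, and by the chain condition also on \<open>Q\<close>.\<close>
  have later: "i R < i R' \<and> j R < j R'" if "R' \<in> D'" for R'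
  proof -
    have R': "R' \<in> D" "R' \<in> C" "R' \<noteq> R" using that D' by (auto simp: D'_def)
    have "i R \<noteq> i R'" using disj[of R R'] R' RC 3 R[of R'] 1 iR[of R']
      by (metis disjoint_iff hd_in_set)
    then have "i R < i R'" using Rmin[of R'] R' by auto
    then show ?thesis using Suc.prems(3)[OF RD R'(1)] by simp
  qed
  have adjP: "successively adj (us @ P1 @ hd R # P2)" and adjQ: "successively adj (ws @ Q1 @ last R # Q2)"
    using Suc.prems dP dQ by auto
  have revR: "successively adj (rev R)" "hd (rev R) = last R" "last (rev R) = hd R" "rev R \<noteq> []"
    using 3 by (auto simp: adj_rev hd_rev last_rev simp del: successively_rev)
  have hops: "successively adj ((us @ P1 @ R) @ Q2)" "successively adj ((ws @ Q1 @ rev R) @ P2)"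
    unfolding append_assoc
    using successively_switch[of adj "us @ P1" R P2 "ws @ Q1" Q2, unfolded append_assoc, OF adjP _ _ adjQ]
      successively_switch[of adj "ws @ Q1" "rev R" Q2 "us @ P1" P2, unfolded append_assoc revR, OF adjQ _ _ adjP]
      3 revR by blast+
  \<comment> \<open>Past \<open>R\<close> the two walks have exchanged rails, so in the induction
    hypothesis the walk coming from \<open>Q\<close> is the one that continues on
    \<open>P\<close>.\<close>
  have "\<exists>B A. successively adj ((ws @ Q1 @ rev R) @ B) \<and> successively adj ((us @ P1 @ R) @ A) \<and> distinct B \<and> distinct A \<and>
    set B \<union> set A \<subseteq> set P2 \<union> set Q2 \<union> (\<Union>R\<in>D'. set R) \<and>
    length P2 + length Q2 + 2 * card D' \<le> length B + length A"
    unfolding P2_def Q2_def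
  proof (rule Suc.hyps(1))
    show "d = card D'" "finite D'" "D' \<subseteq> C" using D' by auto
    show "j R1 < j R2" if "R1 \<in> D'" "R2 \<in> D'" "i R1 < i R2" for R1 R2
      using Suc.prems(3) that D by blast
    show "Suc (i R) \<le> i R' \<and> Suc (j R) \<le> j R'" if "R' \<in> D'" for R'
      using later[OF that] by simp
  qed (use hops P2_def Q2_def in \<open>simp_all only:\<close>)
  then obtain A B where AB: "successively adj (ws @ Q1 @ rev R @ B)" "successively adj (us @ P1 @ R @ A)"
    "distinct B" "distinct A"
    "set B \<union> set A \<subseteq> set P2 \<union> set Q2 \<union> (\<Union>R\<in>D'. set R)"
    "length P2 + length Q2 + 2 * card D' \<le> length B + length A"
    unfolding append_assoc by blast
  \<comment> \<open>A later rung avoids the rail segments before its own ends, and these contain the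
    segments before \<open>R\<close>.\<close>
  have rungs: "set R' \<inter> (set R \<union> set (take (i R) P) \<union> set (take (j R) Q)) = {}" if "R' \<in> D'" for R'
  proof -
    have R': "R' \<in> C" "R' \<noteq> R" using that D' by (auto simp: D'_def)
    have "take (i R) P = take (i R) (take (i R') P)" "take (j R) Q = take (j R) (take (j R') Q)"
      using later[OF that] by auto
    then have "set (take (i R) P) \<subseteq> set (take (i R') P)" "set (take (j R) Q) \<subseteq> set (take (j R') Q)"
      by (metis set_take_subset)+
    then show ?thesis using segments_disjoint(5,6)[OF R'(1)] disj[OF RC R'(1)] R' by blast
  qed
  have sub: "set P1 \<subseteq> set (take (i R) P)" "set Q1 \<subseteq> set (take (j R) Q)"
    unfolding P1_def Q1_def by (rule set_drop_subset)+
  have seg: "set P1 \<inter> set P2 = {}" "set Q1 \<inter> set Q2 = {}" "set P1 \<inter> set Q2 = {}" "set Q1 \<inter> set P2 = {}"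
    "set R \<inter> set P1 = {}" "set R \<inter> set P2 = {}" "set R \<inter> set Q1 = {}" "set R \<inter> set Q2 = {}"
    using segments_disjoint[OF RC] sub unfolding P2_def Q2_def by blast+
  have rung: "set R' \<inter> set R = {}" "set R' \<inter> set P1 = {}" "set R' \<inter> set Q1 = {}" if "R' \<in> D'" for R'
    using rungs[OF that] sub by auto
  have "distinct P1" "distinct Q1" using P Q by (auto simp: P1_def Q1_def)
  have away: "set A \<inter> X = {} \<and> set B \<inter> X = {}"
    if "X \<inter> set P2 = {}" "X \<inter> set Q2 = {}" "\<And>R'. R' \<in> D' \<Longrightarrow> set R' \<inter> X = {}" for X
    using AB(5) that by blast
  have A': "set A \<inter> set P1 = {}" "set A \<inter> set R = {}" and B': "set B \<inter> set Q1 = {}" "set B \<inter> set R = {}"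
    using away[of "set P1"] away[of "set R"] away[of "set Q1"] seg rung by simp_all
  have "distinct R" using 3 by simp
  have dA: "distinct (P1 @ R @ A)"
    using AB(4) \<open>distinct R\<close> \<open>distinct P1\<close> A' seg by (simp add: Int_Un_distrib Int_commute)
  have dB: "distinct (Q1 @ rev R @ B)"
    using AB(3) \<open>distinct R\<close> \<open>distinct Q1\<close> B' seg by (simp add: Int_Un_distrib Int_commute)
  \<comment> \<open>Using \<open>R\<close> twice contributes at least four vertices in place of its
    two ends on the rails, a gain of two.\<close>
  have len: "length (drop a P) + length (drop b Q) + 2 * card D
      \<le> length (P1 @ R @ A) + length (Q1 @ rev R @ B)"
    using AB(6) rung_length[OF RC] D(2) unfolding dP dQ by simp
  define X where "X = set (drop a P) \<union> set (drop b Q) \<union> (\<Union>R\<in>D. set R)"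
  have "set P1 \<subseteq> X" "set Q1 \<subseteq> X" "set R \<subseteq> X" "set P2 \<union> set Q2 \<union> (\<Union>R\<in>D'. set R) \<subseteq> X"
    unfolding X_def dP dQ D(1) by auto
  moreover from order_trans[OF AB(5) this(4)] have "set A \<subseteq> X" "set B \<subseteq> X" by simp_all
  ultimately have "set (P1 @ R @ A) \<union> set (Q1 @ rev R @ B) \<subseteq> X" by simp
  then have "successively adj (us @ P1 @ R @ A) \<and> successively adj (ws @ Q1 @ rev R @ B) \<and>
      distinct (P1 @ R @ A) \<and> distinct (Q1 @ rev R @ B) \<and>
      set (P1 @ R @ A) \<union> set (Q1 @ rev R @ B) \<subseteq> X \<and>
      length (drop a P) + length (drop b Q) + 2 * card D
        \<le> length (P1 @ R @ A) + length (Q1 @ rev R @ B)"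
    using AB(1,2) dA dB len by (intro conjI)
  then show ?case unfolding X_def by (intro exI)
qed

section \<open>Bounding the number of rungs\<close>

lemma crossing:
  assumes "R \<in> C"
  shows "successively adj (take (i R) P @ R @ drop (Suc (j R)) Q)"
    and "distinct (take (i R) P @ R @ drop (Suc (j R)) Q)"
    and "successively adj (take (j R) Q @ rev R @ drop (Suc (i R)) P)"
    and "distinct (take (j R) Q @ rev R @ drop (Suc (i R)) P)"
proof -
  note 1 = iR[OF assms] and 2 = jR[OF assms] and 3 = R[OF assms]
  have revR: "successively adj (rev R)" "hd (rev R) = last R" "last (rev R) = hd R" "rev R \<noteq> []"
    using 3 by (auto simp: adj_rev hd_rev last_rev simp del: successively_rev)
  have adj: "successively adj (take (i R) P @ hd R # drop (Suc (i R)) P)"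
    "successively adj (take (j R) Q @ last R # drop (Suc (j R)) Q)"
    using 1 2 P Q id_take_nth_drop by metis+
  show "successively adj (take (i R) P @ R @ drop (Suc (j R)) Q)"
    by (rule successively_switch[OF adj(1) _ _ adj(2)]) (use 3 in auto)
  show "successively adj (take (j R) Q @ rev R @ drop (Suc (i R)) P)"
    by (rule successively_switch[of _ _ "rev R", unfolded revR, OF adj(2) _ _ adj(1)]) (use revR in blast)+
  show "distinct (take (i R) P @ R @ drop (Suc (j R)) Q)"
    "distinct (take (j R) Q @ rev R @ drop (Suc (i R)) P)"
    using segments_disjoint[OF assms] 3 P Q by auto
qed

text \<open>Single switches confine the slope \<open>j R - i R\<close> to fewer than
  \<open>2 * n\<close> values, grouped into \<open>n\<close> classes of neighbouring slopes. A
  zigzag through one class gains two vertices per rung, and its two walks together have room for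
  only \<open>2 * n\<close> more.\<close>

lemma few_rungs:
  assumes "finite C"
    and verts: "set P \<subseteq> W" "set Q \<subseteq> W" "\<And>R. R \<in> C \<Longrightarrow> set R \<subseteq> W"
    and N: "\<And>xs. successively adj xs \<Longrightarrow> distinct xs \<Longrightarrow> set xs \<subseteq> W \<Longrightarrow> length xs \<le> N"
    and long: "N \<le> length P + n" "N \<le> length Q + n"
  shows "card C \<le> n\<^sup>2"
proof -
  have slope: "i R < j R + n \<and> j R < i R + n" if "R \<in> C" for R
  proof -
    have "length (take (i R) P @ R @ drop (Suc (j R)) Q) \<le> N"
      "length (take (j R) Q @ rev R @ drop (Suc (i R)) P) \<le> N"
      by (rule N; use crossing[OF that] verts verts(3)[OF that] in
          \<open>auto simp del: successively_rev dest: in_set_takeD in_set_dropD\<close>)+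
    then show ?thesis using rung_length[OF that] iR[OF that] jR[OF that] long by auto
  qed
  \<comment> \<open>By \<open>slope\<close>, \<open>j R + n - 1 - i R\<close> runs from 0 to
    \<open>2 * n - 2\<close>. Halving gives a class below \<open>n\<close>, and slopes within a
    class differ by at most one.\<close>
  define c where "c R = (j R + n - 1 - i R) div 2" for R
  define D where "D m = {R \<in> C. c R = m}" for m
  have "C \<subseteq> (\<Union>m<n. D m)"
    using slope by (fastforce simp: D_def c_def)
  have "card (D m) \<le> n" for m
  proof -
    have "\<exists>A B. successively adj ([] @ A) \<and> successively adj ([] @ B) \<and> distinct A \<and> distinct B \<and>
      set A \<union> set B \<subseteq> set (drop 0 P) \<union> set (drop 0 Q) \<union> (\<Union>R\<in>D m. set R) \<and>
      length (drop 0 P) + length (drop 0 Q) + 2 * card (D m) \<le> length A + length B"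
    proof (rule zigzag)
      fix R R' assume R': "R \<in> D m" "R' \<in> D m" "i R < i R'"
      then have "R \<in> C" "R' \<in> C" "c R = c R'" by (auto simp: D_def)
      \<comment> \<open>Nearly equal slopes yield only \<open>j R \<le> j R'\<close>; disjointness
        of the rungs excludes equality.\<close>
      then have "j R \<noteq> j R'"
        using disj[of R R'] jR[of R] jR[of R'] R[of R] R[of R'] R'
        by (metis disjoint_iff last_in_set less_irrefl)
      then show "j R < j R'" using slope[of R] slope[of R'] R' \<open>R \<in> C\<close> \<open>R' \<in> C\<close> \<open>c R = c R'\<close>
        unfolding c_def by linarith
    qed (use \<open>finite C\<close> P Q in \<open>auto simp: D_def\<close>)
    then obtain A B where AB: "successively adj A" "successively adj B" "distinct A" "distinct B"
      "set A \<union> set B \<subseteq> set P \<union> set Q \<union> (\<Union>R\<in>D m. set R)"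
      "length P + length Q + 2 * card (D m) \<le> length A + length B" by auto
    have "set P \<union> set Q \<union> (\<Union>R\<in>D m. set R) \<subseteq> W" using verts by (auto simp: D_def)
    then have "length A \<le> N" "length B \<le> N" using AB by (blast intro: N)+
    then show ?thesis using AB(6) long by simp
  qed
  then have "(\<Sum>m<n. card (D m)) \<le> n * n" using sum_bounded_above[of "{..<n}" "\<lambda>m. card (D m)" n] by simp
  moreover have "card C \<le> card (\<Union>m<n. D m)"
    using \<open>C \<subseteq> _\<close> \<open>finite C\<close> by (intro card_mono) (auto simp: D_def)
  moreover have "\<dots> \<le> (\<Sum>m<n. card (D m))" by (rule card_UN_le) simp
  ultimately show ?thesis by (simp add: power2_eq_square)
qed

end

subsection \<open>Connected parts and bonds\<close>

abbreviation edge_rel :: "'a set \<Rightarrow> 'a set set \<Rightarrow> ('a \<times> 'a) set" where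
  "edge_rel W E \<equiv> {(x, y). x \<in> W \<and> y \<in> W \<and> {x, y} \<in> E}"

lemma rtrancl_walk:
  assumes "(x, y) \<in> r\<^sup>*"
  shows "\<exists>R. R \<noteq> [] \<and> walk r R \<and> hd R = x \<and> last R = y"
  using assms
proof (induction rule: converse_rtrancl_induct)
  case base
  then show ?case by (intro exI[of _ "[y]"]) simp
next
  case (step x z)
  then obtain R where R: "R \<noteq> []" "walk r R" "hd R = z" "last R = y" by blast
  then show ?case using step.hyps by (intro exI[of _ "x # R"]) (simp add: successively_Cons)
qed

lemma walk_edge_rel_subset:
  assumes "walk (edge_rel W E) R" "R \<noteq> []" "hd R \<in> W"
  shows "set R \<subseteq> W"
  using assms
proof (induction R)
  case (Cons a R)
  then show ?case by (cases R) auto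
qed simp

lemma connected_graphD:
  "connected_graph W E \<Longrightarrow> u \<in> W \<Longrightarrow> v \<in> W \<Longrightarrow> (u, v) \<in> (edge_rel W E)\<^sup>*"
  unfolding connected_graph_def by blast

lemma connected_crossing:
  assumes "connected_graph W E" "Y \<subseteq> W" "Y \<noteq> {}" "Y \<noteq> W"
  obtains y z where "y \<in> Y" "z \<in> W - Y" "{y, z} \<in> E"
proof -
  obtain u v where uv: "u \<in> Y" "v \<in> W - Y" using assms by blast
  then have "(u, v) \<in> (edge_rel W E)\<^sup>*" using assms unfolding connected_graph_def by blast
  then have "v \<in> Y" if "\<not> (\<exists>y\<in>Y. \<exists>z\<in>W - Y. {y, z} \<in> E)"
    by (induction rule: rtrancl_induct) (use uv that in auto)
  then show thesis using that uv by blast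
qed

text \<open>No edge leaves the set of vertices reachable from \<open>u\<close>, so this set is all
  of \<open>W\<close>.\<close>

lemma connected_graphI:
  assumes "W \<noteq> {}"
    and cross: "\<And>Y. Y \<subseteq> W \<Longrightarrow> Y \<noteq> {} \<Longrightarrow> Y \<noteq> W \<Longrightarrow> \<exists>y\<in>Y. \<exists>z\<in>W - Y. {y, z} \<in> E"
  shows "connected_graph W E"
  unfolding connected_graph_def
proof (intro conjI ballI)
  fix u v assume uv: "u \<in> W" "v \<in> W"
  let ?Y = "{w \<in> W. (u, w) \<in> (edge_rel W E)\<^sup>*}"
  have "z \<in> ?Y" if "y \<in> ?Y" "z \<in> W" "{y, z} \<in> E" for y z
    using that by (auto intro: rtrancl.rtrancl_into_rtrancl)
  then have "?Y = W" using cross[of ?Y] uv by blast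
  then show "(u, v) \<in> (edge_rel W E)\<^sup>*" using uv by blast
qed fact

lemma connected_graph_insert:
  assumes "connected_graph C E" "c \<in> C" "{c, d} \<in> E"
  shows "connected_graph (insert d C) E"
proof (cases "d \<in> C")
  case True
  then show ?thesis using assms by (simp add: insert_absorb)
next
  case False
  show ?thesis
  proof (rule connected_graphI)
    fix Y assume Y: "Y \<subseteq> insert d C" "Y \<noteq> {}" "Y \<noteq> insert d C"
    consider "Y = {d}" | "Y = C" | "Y \<inter> C \<noteq> {}" "Y \<inter> C \<noteq> C" using Y by blast
    then show "\<exists>y\<in>Y. \<exists>z\<in>insert d C - Y. {y, z} \<in> E"
    proof cases
      case 1
      then show ?thesis using assms False by (auto simp: insert_commute)
    next
      case 2
      then show ?thesis using assms False by auto
    next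
      case 3
      then obtain y z where "y \<in> Y \<inter> C" "z \<in> C - Y \<inter> C" "{y, z} \<in> E"
        using connected_crossing[OF assms(1), of "Y \<inter> C"] by blast
      then show ?thesis by auto
    qed
  qed simp
qed

lemma connected_graph_singleton: "connected_graph {v} E"
  by (auto simp: connected_graph_def)

lemma is_path_iff:
  "is_path V E xs \<longleftrightarrow> xs \<noteq> [] \<and> distinct xs \<and> set xs \<subseteq> V \<and> successively (\<lambda>x y. {x, y} \<in> E) xs"
  unfolding is_path_def successively_conv_nth by simp

lemma cut_ofI: "x \<in> X \<Longrightarrow> y \<in> V - X \<Longrightarrow> {x, y} \<in> E \<Longrightarrow> {x, y} \<in> cut_of V E X"
  unfolding cut_of_def by blast

text \<open>Consecutive vertices lie on the same side, as an edge changing sides would belong to the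
  cut.\<close>

lemma path_avoiding_cut:
  assumes "is_path V E xs" "path_edges xs \<inter> cut_of V E X = {}"
  shows "set xs \<subseteq> X \<or> set xs \<subseteq> V - X"
proof -
  have "successively (\<lambda>x y. {x, y} \<in> E \<and> {x, y} \<notin> cut_of V E X) xs"
    using assms unfolding is_path_def path_edges_def successively_conv_nth by blast
  moreover have "set xs \<subseteq> V" using assms by (simp add: is_path_def)
  ultimately show ?thesis
  proof (induction xs)
    case (Cons a xs)
    show ?case
    proof (cases xs)
      case (Cons b ys)
      have "a \<in> X \<longleftrightarrow> b \<in> X"
        using Cons.prems cut_ofI[of a X b V E] cut_ofI[of b X a V E]
        unfolding Cons by (auto simp: insert_commute)
      then show ?thesis using Cons.IH Cons.prems unfolding Cons by auto
    qed (use Cons.prems in auto)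
  qed simp
qed

text \<open>A nonempty edge cut inside this one splits neither side: a side is connected, and an
  edge within it is not in \<open>cut_of V E X\<close>. Its defining set is therefore one of the two
  sides, and both define the same cut.\<close>

lemma is_bond_cut_of:
  assumes "connected_graph V E" "X \<subseteq> V" "connected_graph X E" "connected_graph (V - X) E"
  shows "is_bond V E (cut_of V E X)"
  unfolding is_bond_def
proof (intro conjI allI impI)
  show "is_edge_cut V E (cut_of V E X)" using assms(2) unfolding is_edge_cut_def by blast
  have ne: "X \<noteq> {}" "X \<noteq> V" using assms by (auto simp: connected_graph_def)
  with assms(1,2) obtain y z where "y \<in> X" "z \<in> V - X" "{y, z} \<in> E"
    using connected_crossing by metis
  then show "cut_of V E X \<noteq> {}" using cut_ofI[of y X z V E] by blast
  fix F' assume F': "is_edge_cut V E F' \<and> F' \<noteq> {} \<and> F' \<subseteq> cut_of V E X"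
  then obtain X' where X': "X' \<subseteq> V" "F' = cut_of V E X'" unfolding is_edge_cut_def by blast
  have unsplit: "W \<inter> X' = {} \<or> W \<subseteq> X'"
    if W: "connected_graph W E" "W \<subseteq> V" "W \<subseteq> X \<or> W \<subseteq> V - X" for W
  proof (rule ccontr)
    assume "\<not> ?thesis"
    then obtain y z where yz: "y \<in> W \<inter> X'" "z \<in> W - W \<inter> X'" "{y, z} \<in> E"
      using connected_crossing[OF W(1), of "W \<inter> X'"] by blast
    then have "{y, z} \<in> cut_of V E X" using F' X' cut_ofI[of y X' z V E] W by blast
    then show False using yz W unfolding cut_of_def by (auto simp: doubleton_eq_iff)
  qed
  have "cut_of V E X' \<noteq> {}" using F' X' by simp
  then have "X' \<noteq> {}" "X' \<noteq> V" by (auto simp: cut_of_def)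
  then have "X' = X \<or> X' = V - X"
    using unsplit[OF assms(3)] unsplit[OF assms(4)] X' assms(2) by blast
  moreover have "cut_of V E (V - X) = cut_of V E X"
    using assms(2) unfolding cut_of_def by (auto simp: insert_commute)
  ultimately show "F' = cut_of V E X" using X' by auto
qed

text \<open>Among the vertices of \<open>X\<close> with a neighbour outside, choose \<open>v\<close> such that \<open>X - {v}\<close> has
  the largest possible connected part.\<close>

lemma movable_vertex:
  assumes "finite V" "X \<subseteq> V" "2 \<le> card X" "connected_graph V E"
    and "connected_graph X E" "connected_graph (V - X) E"
    and del: "\<And>v. v \<in> V \<Longrightarrow> connected_graph (V - {v}) E"
  obtains v where "v \<in> X" "connected_graph (X - {v}) E" "connected_graph (insert v (V - X)) E"
proof -
  define good where
    "good v C \<longleftrightarrow> v \<in> X \<and> (\<exists>w\<in>V - X. {v, w} \<in> E) \<and> C \<subseteq> X - {v} \<and> connected_graph C E" for v C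
  have fin: "finite X" using assms finite_subset by blast
  have "X \<noteq> {}" "X \<noteq> V" using assms by (auto simp: connected_graph_def)
  with assms obtain v w where vw: "v \<in> X" "w \<in> V - X" "{v, w} \<in> E"
    using connected_crossing by metis
  have "X \<noteq> {v}" using assms(3) by auto
  then obtain u where "u \<in> X - {v}" using vw by blast
  then have "good v {u}" using vw connected_graph_singleton[of u E] unfolding good_def by blast
  then have "(\<lambda>q. good (fst q) (snd q)) (v, {u})" by simp
  moreover have "\<forall>q. (\<lambda>q. good (fst q) (snd q)) q \<longrightarrow> (\<lambda>q. card (snd q)) q < Suc (card X)"
  proof (intro allI impI)
    fix q :: "'a \<times> 'a set" assume "(\<lambda>q. good (fst q) (snd q)) q"
    then have "snd q \<subseteq> X" unfolding good_def by blast
    then show "(\<lambda>q. card (snd q)) q < Suc (card X)" using card_mono[OF fin] by (simp add: less_Suc_eq_le)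
  qed
  ultimately have "\<exists>q. (\<lambda>q. good (fst q) (snd q)) q \<and>
      (\<forall>q'. (\<lambda>q. good (fst q) (snd q)) q' \<longrightarrow> (\<lambda>q. card (snd q)) q' \<le> (\<lambda>q. card (snd q)) q)"
    by (rule ex_has_greatest_nat)
  then obtain v C where good: "good v C" and max: "\<And>v' C'. good v' C' \<Longrightarrow> card C' \<le> card C"
    by auto
  have v: "v \<in> X" "C \<subseteq> X - {v}" "connected_graph C E" and "\<exists>w\<in>V - X. {v, w} \<in> E"
    using good unfolding good_def by auto
  then obtain w where w: "w \<in> V - X" "{v, w} \<in> E" by blast
  have "finite C" using v fin finite_subset by blast
  \<comment> \<open>By maximality \<open>C\<close> is a whole component of
    \<open>X - {v}\<close>.\<close>
  have closed: "d \<in> C" if "c \<in> C" "d \<in> X - {v}" "{c, d} \<in> E" for c d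
  proof (rule ccontr)
    assume "d \<notin> C"
    have "good v (insert d C)"
      using v w that connected_graph_insert[OF v(3) that(1) that(3)] unfolding good_def by blast
    then show False using max[of v "insert d C"] \<open>d \<notin> C\<close> \<open>finite C\<close> by simp
  qed
  have "C = X - {v}"
  proof (rule ccontr)
    assume "C \<noteq> X - {v}"
    \<comment> \<open>Connectivity of \<open>V - {v}\<close> gives an edge leaving the remainder
      \<open>D\<close> from some \<open>y\<close>; it cannot lead to \<open>C\<close>, so it leaves
      \<open>X\<close>. Then \<open>y\<close> with the larger part \<open>insert v C\<close>
      contradicts the choice of \<open>v\<close> and \<open>C\<close>.\<close>
    define D where "D = X - {v} - C"
    have "D \<noteq> {}" "D \<subseteq> V - {v}" "D \<noteq> V - {v}"
      using \<open>C \<noteq> X - {v}\<close> v assms(2) w by (auto simp: D_def)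
    then obtain y z where yz: "y \<in> D" "z \<in> V - {v} - D" "{y, z} \<in> E"
      using connected_crossing[OF del[of v], of D] v assms(2) by blast
    have "z \<notin> C" using closed[of z y] yz by (auto simp: D_def insert_commute)
    then have z: "z \<in> V - X" using yz by (auto simp: D_def)
    have "C \<noteq> {}" "C \<noteq> X" using v by (auto simp: connected_graph_def)
    then obtain c d where cd: "c \<in> C" "d \<in> X - C" "{c, d} \<in> E"
      using connected_crossing[OF assms(5), of C] v by blast
    then have "d = v" using closed[of c d] by auto
    then have "connected_graph (insert v C) E" using connected_graph_insert[OF v(3) cd(1)] cd(3) by simp
    moreover have "y \<in> X" "insert v C \<subseteq> X - {y}" using yz v by (auto simp: D_def)
    ultimately have "good y (insert v C)" using yz(3) z unfolding good_def by blast
    then have "card (insert v C) \<le> card C" by (rule max)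
    moreover have "v \<notin> C" using v(2) by blast
    ultimately show False using \<open>finite C\<close> by simp
  qed
  moreover have "connected_graph (insert v (V - X)) E"
    using connected_graph_insert[OF assms(6) w(1), of v] w by (simp add: insert_commute)
  ultimately show thesis using that v by auto
qed

subsection \<open>Long paths in highly connected graphs\<close>

text \<open>Sizes are counted in vertices: \<open>N\<close> bounds every path, and a path is long if
  \<open>N \<le> length xs + n\<close>.\<close>

locale long_paths =
  fixes V :: "'a set" and E :: "'a set set" and k N n :: nat
  assumes fin: "finite V" and cardV: "k < card V"
    and conn: "\<And>S. S \<subseteq> V \<Longrightarrow> card S < k \<Longrightarrow> connected_graph (V - S) E"
    and bound: "\<And>xs. is_path V E xs \<Longrightarrow> length xs \<le> N"
    and kn: "2 * n\<^sup>2 + 3 \<le> k" and kN: "k < N"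
begin

abbreviation adj :: "'a \<Rightarrow> 'a \<Rightarrow> bool" where
  "adj x y \<equiv> {x, y} \<in> E"

text \<open>Fewer than \<open>m\<close> separating vertices together with \<open>S\<close> are fewer
  than \<open>k\<close>; deleting them leaves a connected graph that still contains a vertex of
  \<open>A\<close> and one of \<open>B\<close>.\<close>

lemma connectors:
  assumes "S \<subseteq> V" "A \<subseteq> V - S" "B \<subseteq> V - S" "card S + m \<le> k" "m \<le> card A" "m \<le> card B"
  shows "linked (edge_rel (V - S) E) A B m"
proof (rule menger)
  show "finite A" "finite B" using assms(2,3) fin by (auto intro: finite_subset[of _ V])
  show "finite (edge_rel (V - S) E)"
    by (rule finite_subset[of _ "V \<times> V"]) (use fin in auto)
  fix T assume T: "finite T" "separates (edge_rel (V - S) E) A B T"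
  show "m \<le> card T"
  proof (rule ccontr)
    assume "\<not> m \<le> card T"
    then have "\<not> A \<subseteq> T" "\<not> B \<subseteq> T"
      using assms(5,6) card_mono[OF T(1), of A] card_mono[OF T(1), of B] by auto
    then obtain a b where ab: "a \<in> A - T" "b \<in> B - T" by blast
    define U where "U = S \<union> (T \<inter> V)"
    have "card U \<le> card S + card (T \<inter> V)" unfolding U_def by (rule card_Un_le)
    also have "card (T \<inter> V) \<le> card T" using T by (intro card_mono) auto
    finally have "card U < k" using \<open>\<not> m \<le> card T\<close> assms by simp
    moreover have "U \<subseteq> V" using assms(1) by (simp add: U_def)
    ultimately have "connected_graph (V - U) E" by (intro conn)
    moreover have "a \<in> V - U" "b \<in> V - U" using ab assms(2,3) by (auto simp: U_def)
    ultimately have "(a, b) \<in> (edge_rel (V - U) E)\<^sup>*" by (rule connected_graphD)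
    from rtrancl_walk[OF this] obtain R
      where R: "R \<noteq> []" "walk (edge_rel (V - U) E) R" "hd R = a" "last R = b"
      by (elim exE conjE) (rule that)
    then have "set R \<subseteq> V - U" using \<open>a \<in> V - U\<close> walk_edge_rel_subset[OF R(2,1)] by simp
    then have "set R \<inter> T = {}" by (auto simp: U_def)
    moreover have "walk (edge_rel (V - S) E) R"
      by (rule walk_mono[OF R(2)]) (auto simp: U_def)
    ultimately show False using T(2)[unfolded separates_def, rule_format, of R] R ab by simp
  qed
qed

lemma connector_in:
  assumes "connector (edge_rel W E) A B R" "A \<subseteq> W"
  shows "set R \<subseteq> W" "successively adj R"
proof -
  have R: "walk (edge_rel W E) R" "R \<noteq> []" "hd R \<in> W"
    using assms unfolding connector_def by auto
  show "set R \<subseteq> W" by (rule walk_edge_rel_subset[OF R])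
  show "successively adj R" by (rule successively_mono[OF R(1)]) simp
qed

lemma adj_rev: "successively adj (rev xs) = successively adj xs"
  by (simp add: insert_commute)

text \<open>Deleting all of \<open>P\<close> but its last vertex leaves a connected graph, so some
  path \<open>R\<close> leads from there to \<open>T\<close>. It can be continued along either part
  of \<open>T\<close>; the claim is the sum of the two length bounds, with
  \<open>2 \<le> length R\<close>.\<close>

lemma extend_to_disjoint_path:
  assumes P: "is_path V E P" "length P \<le> k" and T: "is_path V E T" and "set P \<inter> set T = {}"
  shows "2 * length P + length T + 1 \<le> 2 * N"
proof -
  define u where "u = last P"
  define X where "X = butlast P"
  have PX: "P = X @ [u]" using P by (simp add: u_def X_def is_path_def)
  have X: "u \<notin> set X" "distinct X" "set X \<subseteq> V" "u \<in> V" "successively adj (X @ [u])"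
    using P unfolding PX is_path_iff by auto
  then have cX: "card (set X) + 1 = length P" unfolding PX by (simp add: distinct_card)
  have dT: "distinct T" "T \<noteq> []" "set T \<subseteq> V" "successively adj T" using T unfolding is_path_iff by auto
  have disj: "set X \<inter> set T = {}" "u \<notin> set T" using assms(4) unfolding PX by auto
  have "1 \<le> card (set T)" using dT by (simp add: Suc_le_eq card_gt_0_iff)
  moreover have "{u} \<subseteq> V - set X" "set T \<subseteq> V - set X" using X dT disj by auto
  moreover have "card (set X) + 1 \<le> k" using cX P(2) by simp
  ultimately have "linked (edge_rel (V - set X) E) {u} (set T) 1"
    using X(3) by (intro connectors) auto
  then obtain C where C: "card C = 1" "\<forall>R\<in>C. connector (edge_rel (V - set X) E) {u} (set T) R"
    unfolding linked_def by auto
  from C(1) obtain R where "C = {R}" by (rule card_1_singletonE)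
  with C(2) have R: "connector (edge_rel (V - set X) E) {u} (set T) R" by simp
  have RV: "set R \<subseteq> V - set X" "successively adj R"
    using connector_in[OF R] \<open>{u} \<subseteq> V - set X\<close> by auto
  have R': "R \<noteq> []" "hd R = u" "distinct R" "set R \<inter> set T = {last R}"
    using R unfolding connector_def by auto
  have mem: "x = last R" if "x \<in> set R" "x \<in> set T" for x
    using R'(4) that by auto
  have "last R \<in> set T" using R'(4) by blast
  then obtain T1 T2 where T12: "T = T1 @ last R # T2" by (meson split_list)
  have "hd R \<noteq> last R" using \<open>last R \<in> set T\<close> disj R'(2) by auto
  then have "2 \<le> length R" using R'(1) by (cases R rule: remdups_adj.cases) auto
  have "successively adj (X @ R @ T2)"
    using successively_switch[of adj X R "[]" T1 T2] X RV R' dT(4) unfolding T12 by simp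
  moreover have "successively adj (X @ R @ rev T1)"
  proof -
    have "successively adj (rev T)" using dT(4) by (simp only: adj_rev)
    then have "successively adj (rev T2 @ last R # rev T1)" unfolding T12 by (simp del: successively_rev)
    then show ?thesis using successively_switch[of adj X R "[]" "rev T2" "rev T1"] X RV R' by blast
  qed
  moreover have RT: "set R \<inter> set T1 = {}" "set R \<inter> set T2 = {}" "set X \<inter> set T1 = {}" "set X \<inter> set T2 = {}"
    "set X \<inter> set R = {}" "distinct T1" "distinct T2" "set T1 \<subseteq> V" "set T2 \<subseteq> V"
    using mem dT disj(1) RV(1) unfolding T12 by auto
  moreover have "distinct (X @ R @ T2)" "distinct (X @ R @ rev T1)"
    using RT R'(3) X(2) by (simp_all add: Int_Un_distrib)
  moreover have "set (X @ R @ T2) \<subseteq> V" "set (X @ R @ rev T1) \<subseteq> V"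
    using RT(8,9) RV(1) X(3) by auto
  ultimately have "is_path V E (X @ R @ T2)" "is_path V E (X @ R @ rev T1)"
    unfolding is_path_iff using R'(1) by simp_all
  then have "length (X @ R @ T2) \<le> N" "length (X @ R @ rev T1) \<le> N" by (auto dest: bound)
  then show ?thesis using \<open>2 \<le> length R\<close> unfolding PX T12 by simp
qed

lemma long_path_not_small:
  assumes P: "is_path V E P" "N \<le> length P + n" and Q: "is_path V E Q" "N \<le> length Q + n"
    and PQ: "set P \<inter> set Q \<subseteq> {v}"
  shows "2 * n\<^sup>2 + 1 < length P"
proof (rule ccontr)
  assume "\<not> ?thesis"
  then have small: "length P \<le> k" using kn by simp
  have "n \<le> n\<^sup>2" by (simp add: power2_eq_square)
  then have "2 \<le> length Q" using Q kN kn by simp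
  \<comment> \<open>\<open>T\<close> is the longer part of \<open>Q\<close> on one side of
    \<open>v\<close>, or all of \<open>Q\<close> if \<open>v\<close> is not on it.\<close>
  have "\<exists>T. is_path V E T \<and> set P \<inter> set T = {} \<and> length Q \<le> 2 * length T + 1"
  proof (cases "v \<in> set Q")
    case True
    then obtain Q1 Q2 where eq: "Q = Q1 @ v # Q2" by (meson split_list)
    define T where "T = (if length Q1 \<le> length Q2 then Q2 else Q1)"
    have "successively adj T" using Q(1) unfolding is_path_iff eq
      by (auto simp: successively_append_iff successively_Cons T_def)
    moreover have "length Q \<le> 2 * length T + 1" unfolding eq T_def by auto
    moreover have "T \<noteq> []" using \<open>2 \<le> length Q\<close> \<open>length Q \<le> 2 * length T + 1\<close> by auto
    moreover have "distinct T" "set T \<subseteq> V" "v \<notin> set T" "set T \<subseteq> set Q"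
      using Q(1) unfolding is_path_iff eq T_def by auto
    ultimately show ?thesis using PQ by (intro exI[of _ T]) (auto simp: is_path_iff)
  next
    case False
    then show ?thesis using Q PQ by (intro exI[of _ Q]) auto
  qed
  then obtain T where T: "is_path V E T" "set P \<inter> set T = {}" "length Q \<le> 2 * length T + 1" by blast
  then have "2 * length P + length T + 1 \<le> 2 * N"
    using extend_to_disjoint_path P small by blast
  \<comment> \<open>Both long paths miss at most \<open>n\<close> of \<open>N\<close> vertices, so
    the bound gives \<open>N + 1 \<le> 5 * n\<close>, while
    \<open>2 * n\<^sup>2 + 4 \<le> N\<close>.\<close>
  then have "2 * n\<^sup>2 + 5 \<le> 5 * n" using T P Q kN kn by linarith
  moreover have "5 * n \<le> 2 * n\<^sup>2 + 4"
  proof (cases "n \<le> 2")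
    case True
    then have "n = 0 \<or> n = 1 \<or> n = 2" by auto
    then show ?thesis by auto
  next
    case False
    then have "3 * n \<le> n * n" by (intro mult_right_mono) auto
    then show ?thesis unfolding power2_eq_square by linarith
  qed
  ultimately show False by simp
qed

lemma long_paths_meet:
  assumes P: "is_path V E P" "N \<le> length P + n" and Q: "is_path V E Q" "N \<le> length Q + n"
    and v: "v \<in> V"
  shows "\<not> set P \<inter> set Q \<subseteq> {v}"
proof
  assume PQ: "set P \<inter> set Q \<subseteq> {v}"
  define A B where "A = set P - {v}" and "B = set Q - {v}"
  have P': "distinct P" "set P \<subseteq> V" "successively adj P" and Q': "distinct Q" "set Q \<subseteq> V" "successively adj Q"
    using P Q unfolding is_path_iff by auto
  have "length P - 1 \<le> card A" "length Q - 1 \<le> card B"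
    unfolding A_def B_def using P' Q'
    by (metis List.finite_set card_Diff1_le distinct_card
        card_Diff_singleton_if diff_le_self le_refl)+
  moreover have "2 * n\<^sup>2 + 1 < length P" "2 * n\<^sup>2 + 1 < length Q"
    using long_path_not_small[OF P Q PQ] long_path_not_small[OF Q P, of v] PQ by auto
  ultimately have "linked (edge_rel (V - {v}) E) A B (2 * n\<^sup>2 + 1)"
    using P' Q' v kn by (intro connectors) (auto simp: A_def B_def)
  then obtain C where C: "finite C" "card C = 2 * n\<^sup>2 + 1"
    and CR: "\<And>R. R \<in> C \<Longrightarrow> connector (edge_rel (V - {v}) E) A B R"
    and Cd: "\<And>R R'. R \<in> C \<Longrightarrow> R' \<in> C \<Longrightarrow> R \<noteq> R' \<Longrightarrow> set R \<inter> set R' = {}"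
    unfolding linked_def by auto
  have RV: "set R \<subseteq> V - {v}" "successively adj R" if "R \<in> C" for R
    using connector_in[OF CR[OF that]] P' by (auto simp: A_def)
  \<comment> \<open>As the connectors avoid \<open>v\<close>, meeting \<open>A\<close> or
    \<open>B\<close> is the same as meeting \<open>P\<close> or \<open>Q\<close>.\<close>
  have R: "R \<noteq> []" "distinct R" "set R \<inter> set P = {hd R}" "set R \<inter> set Q = {last R}" if "R \<in> C" for R
    using CR[OF that] RV(1)[OF that] unfolding connector_def A_def B_def by auto
  have "\<forall>R\<in>C. \<exists>a. a < length P \<and> hd R = P ! a"
  proof
    fix R assume "R \<in> C"
    then have "hd R \<in> set P" using R by blast
    then show "\<exists>a. a < length P \<and> hd R = P ! a" by (metis in_set_conv_nth)
  qed
  then obtain i where i: "\<And>R. R \<in> C \<Longrightarrow> i R < length P \<and> hd R = P ! i R" by metis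
  have "\<forall>R\<in>C. \<exists>a. a < length Q \<and> last R = Q ! a"
  proof
    fix R assume "R \<in> C"
    then have "last R \<in> set Q" using R by blast
    then show "\<exists>a. a < length Q \<and> last R = Q ! a" by (metis in_set_conv_nth)
  qed
  then obtain j where j: "\<And>R. R \<in> C \<Longrightarrow> j R < length Q \<and> last R = Q ! j R" by metis
  \<comment> \<open>\<open>a\<close> and \<open>b\<close> are the positions of the common vertex;
    for disjoint paths the condition is vacuous and any values serve.\<close>
  obtain a b where ab: "\<And>a' b'. a' < length P \<Longrightarrow> b' < length Q \<Longrightarrow> P ! a' = Q ! b' \<Longrightarrow>
      a' = a \<and> b' = b \<and> P ! a' = v"
  proof (cases "\<exists>a b. a < length P \<and> b < length Q \<and> P ! a = Q ! b")
    case True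
    then obtain a b where ab: "a < length P" "b < length Q" "P ! a = Q ! b" by blast
    have common: "P ! a' = v" if "a' < length P" "b' < length Q" "P ! a' = Q ! b'" for a' b'
    proof -
      have "P ! a' \<in> set P \<inter> set Q" using that nth_mem by (metis IntI)
      then show ?thesis using PQ by blast
    qed
    show thesis
    proof (rule that[of a b])
      fix a' b' assume *: "a' < length P" "b' < length Q" "P ! a' = Q ! b'"
      show "a' = a \<and> b' = b \<and> P ! a' = v"
        using common[OF *] common[OF ab] * ab P'(1) Q'(1) by (metis nth_eq_iff_index_eq)
    qed
  qed blast
  have ne: "i R \<noteq> a' \<and> j R \<noteq> b'"
    if "R \<in> C" "a' < length P" "b' < length Q" "P ! a' = Q ! b'" for R a' b'
  proof -
    have "P ! a' = v" "Q ! b' = v" using ab[OF that(2-4)] that(4) by auto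
    moreover have "hd R \<noteq> v" "last R \<noteq> v"
      using RV(1)[OF that(1)] hd_in_set[OF R(1)[OF that(1)]] last_in_set[OF R(1)[OF that(1)]] by auto
    ultimately show ?thesis using i[OF that(1)] j[OF that(1)] by auto
  qed
  \<comment> \<open>\<open>C1\<close> collects the connectors attaching on the same side of
    \<open>v\<close> on both paths, \<open>C2\<close> those on opposite sides. Reversing
    \<open>Q\<close>, with positions \<open>j'\<close>, turns \<open>C2\<close> into a ladder as
    well.\<close>
  define C1 C2 where "C1 = {R \<in> C. i R < a \<longleftrightarrow> j R < b}" and "C2 = {R \<in> C. i R < a \<longleftrightarrow> \<not> j R < b}"
  define j' where "j' R = length Q - 1 - j R" for R
  interpret L1: ladder adj P Q C1 i j
  proof
    show "i R < a' \<and> j R < b' \<or> a' < i R \<and> b' < j R"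
      if "R \<in> C1" "a' < length P" "b' < length Q" "P ! a' = Q ! b'" for R a' b'
      using ab[OF that(2-4)] ne[of R a' b'] that by (auto simp: C1_def)
  qed (use P' Q' R RV i j Cd in \<open>auto simp: C1_def insert_commute\<close>)
  interpret L2: ladder adj P "rev Q" C2 i j'
  proof
    show "i R < a' \<and> j' R < b' \<or> a' < i R \<and> b' < j' R"
      if "R \<in> C2" "a' < length P" "b' < length (rev Q)" "P ! a' = rev Q ! b'" for R a' b'
    proof -
      have 1: "length Q - 1 - b' < length Q" "P ! a' = Q ! (length Q - 1 - b')"
        using that by (auto simp: rev_nth)
      show ?thesis
        using ab[OF that(2) 1] ne[OF _ that(2) 1, of R] that j[of R] by (auto simp: C2_def j'_def)
    qed
    show "successively adj (rev Q)" using Q' adj_rev by simp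
    show "j' R < length (rev Q) \<and> last R = rev Q ! j' R \<and> set R \<inter> set (rev Q) = {last R}"
      if "R \<in> C2" for R
      using that R j[of R] by (auto simp: C2_def j'_def rev_nth)
  qed (use P' Q' R RV i Cd in \<open>auto simp: C2_def insert_commute\<close>)
  have fin12: "finite C1" "finite C2" using C by (auto simp: C1_def C2_def)
  have RV1: "set R \<subseteq> V" if "R \<in> C1" for R using RV[of R] that by (auto simp: C1_def)
  have RV2: "set R \<subseteq> V" if "R \<in> C2" for R using RV[of R] that by (auto simp: C2_def)
  have N: "length xs \<le> N" if "successively adj xs" "distinct xs" "set xs \<subseteq> V" for xs
    using bound[of xs] that by (cases "xs = []") (auto simp: is_path_iff)
  have "card C1 \<le> n\<^sup>2"
    by (rule L1.few_rungs[OF fin12(1) P'(2) Q'(2) RV1 N]) (use P Q in auto)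
  moreover have "card C2 \<le> n\<^sup>2"
    by (rule L2.few_rungs[OF fin12(2) P'(2) _ RV2 N]) (use P Q Q' in auto)
  moreover have "C = C1 \<union> C2" by (auto simp: C1_def C2_def)
  ultimately show False using C(2) card_Un_le[of C1 C2] by simp
qed

lemma bond_meeting_long_paths:
  "\<exists>F. is_bond V E F \<and> (\<forall>xs. is_path V E xs \<and> N \<le> length xs + n \<longrightarrow> path_edges xs \<inter> F \<noteq> {})"
proof (rule ccontr)
  assume no_bond: "\<not> ?thesis"
  have VE: "connected_graph V E" using conn[of "{}"] kn by simp
  have del: "connected_graph (V - {v}) E" if "v \<in> V" for v
    using conn[of "{v}"] that kn by simp
  have n: "n \<le> n\<^sup>2" by (simp add: power2_eq_square)
  define long where "long xs \<longleftrightarrow> is_path V E xs \<and> N \<le> length xs + n" for xs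
  define split where "split X \<longleftrightarrow> X \<subseteq> V \<and> connected_graph X E \<and> connected_graph (V - X) E" for X
  have side: "\<exists>xs. long xs \<and> (set xs \<subseteq> X \<or> set xs \<subseteq> V - X)" if "split X" for X
  proof -
    have "is_bond V E (cut_of V E X)"
      using that is_bond_cut_of[OF VE] unfolding split_def by blast
    then obtain xs where "long xs" "path_edges xs \<inter> cut_of V E X = {}"
      using no_bond unfolding long_def by blast
    then show ?thesis using path_avoiding_cut unfolding long_def by blast
  qed
  \<comment> \<open>This rules out a single vertex as the side containing a long path, and supplies
    the size condition of \<open>movable_vertex\<close>.\<close>
  have long_card: "2 \<le> card X" if "long xs" "set xs \<subseteq> X" "X \<subseteq> V" for xs X
  proof -
    have "length xs = card (set xs)" using that by (simp add: long_def is_path_def distinct_card)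
    also have "\<dots> \<le> card X" using that fin finite_subset by (intro card_mono) auto
    finally show ?thesis using that kN kn n unfolding long_def by linarith
  qed
  define heavy where "heavy X \<longleftrightarrow> split X \<and> (\<exists>xs. long xs \<and> set xs \<subseteq> X)" for X
  obtain w where w: "w \<in> V" using cardV by fastforce
  then have "V - (V - {w}) = {w}" by auto
  then have "split (V - {w})"
    using del[OF w] connected_graph_singleton[of w E] by (simp add: split_def)
  moreover have "\<not> (long xs \<and> set xs \<subseteq> {w})" for xs
    using long_card[of xs "{w}"] w by auto
  ultimately have "heavy (V - {w})"
    using side[of "V - {w}"] \<open>V - (V - {w}) = {w}\<close> unfolding heavy_def by auto
  then obtain X where X: "heavy X" and min: "\<And>Y. heavy Y \<Longrightarrow> card X \<le> card Y"
    using ex_has_least_nat[of heavy _ card] by blast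
  then obtain P where P: "long P" "set P \<subseteq> X" and XV: "X \<subseteq> V" "connected_graph X E" "connected_graph (V - X) E"
    unfolding heavy_def split_def by blast
  obtain v where v: "v \<in> X" "connected_graph (X - {v}) E" "connected_graph (insert v (V - X)) E"
    using movable_vertex[OF fin XV(1) long_card[OF P XV(1)] VE XV(2,3) del] by blast
  have compl: "V - (X - {v}) = insert v (V - X)" using v XV by auto
  then have "split (X - {v})" using v XV unfolding split_def by auto
  \<comment> \<open>By minimality the smaller part has no long path, so the one given by
    \<open>side\<close> lies in the other part.\<close>
  moreover have "\<not> heavy (X - {v})"
  proof
    assume "heavy (X - {v})"
    then have "card X \<le> card (X - {v})" by (rule min)
    then show False using card_Diff1_less[of X v] v XV fin finite_subset by fastforce
  qed
  ultimately obtain Q where Q: "long Q" "set Q \<subseteq> insert v (V - X)"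
    using side[of "X - {v}"] compl unfolding heavy_def by auto
  have "set P \<inter> set Q \<subseteq> {v}" using P Q by auto
  then show False using long_paths_meet[of P Q v] P Q v XV unfolding long_def by blast
qed

end

section \<open>From k-connectivity and the parity of the longest path to the counting
  hypotheses\<close>

lemma connected_del_verts:
  "connected_graph (V - S) (del_verts_E E S) = connected_graph (V - S) E"
proof -
  have "edge_rel (V - S) (del_verts_E E S) = edge_rel (V - S) E"
    by (auto simp: del_verts_E_def)
  then show ?thesis unfolding connected_graph_def by simp
qed

text \<open>Deleting all vertices but the last one removes fewer than \<open>k\<close>, and the last
  vertex has a neighbour in the connected rest. Hence a longest path has more than \<open>k\<close>
  vertices.\<close>

lemma k_connected_extend_path:
  assumes "finite V" "k_connected k V E" "is_path V E xs" "length xs \<le> k"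
  shows "\<exists>z. is_path V E (xs @ [z])"
proof -
  define S where "S = set (butlast xs)"
  have xs: "xs \<noteq> []" "distinct xs" "set xs \<subseteq> V" "successively (\<lambda>x y. {x, y} \<in> E) xs"
    using assms(3) by (auto simp: is_path_iff)
  then have eq: "xs = butlast xs @ [last xs]" by simp
  then have S: "set xs = insert (last xs) S" "last xs \<notin> S"
    unfolding S_def using xs(2)
    by (metis list.set(1,2) set_append Un_insert_right sup_bot_right,
        metis distinct_append not_distinct_conv_prefix)
  have "card S < k" using assms(4) xs S distinct_card[OF xs(2)] by (auto simp: S_def)
  then have "connected_graph (V - S) E"
    using assms(2) xs S unfolding k_connected_def connected_del_verts by blast
  moreover have "card (set xs) < card V"
    using assms distinct_card[OF xs(2)] by (simp add: k_connected_def)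
  then have "\<not> V \<subseteq> set xs" using card_mono[of "set xs" V] by auto
  then have "V - S \<noteq> {last xs}" using S(1) by auto
  ultimately obtain y z where "y \<in> {last xs}" "z \<in> V - S - {last xs}" "{y, z} \<in> E"
    using connected_crossing[of "V - S" E "{last xs}"] S xs by blast
  then show ?thesis using xs S
    by (intro exI[of _ z]) (auto simp: is_path_iff successively_append_iff)
qed

theorem theorem5:
  fixes V :: "'a set" and E :: "'a set set" and k :: nat
  assumes "simple_graph V E"
    and "k \<ge> 3"
    and "k_connected k V E"
  defines "p \<equiv> longest_path_length V E"
  defines "t \<equiv> (if even p then \<lfloor>sqrt ((real k - 2) / 2)\<rfloor>
                           else \<lceil>sqrt ((real k - 2) / 2)\<rceil>)"
  shows "\<exists>F. is_bond V E F \<and>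
           (\<forall>xs. is_path V E xs \<and> int (path_length xs) \<ge> int p - t + 1
                 \<longrightarrow> path_edges xs \<inter> F \<noteq> {})"
proof -
  have fin: "finite V" using assms(1) by (simp add: simple_graph_def)
  have paths: "finite {xs. is_path V E xs}"
    by (rule finite_subset[OF _ finite_subset_distinct[OF fin]]) (auto simp: is_path_def)
  have "V \<noteq> {}" using assms(3) by (auto simp: k_connected_def)
  then obtain w where "w \<in> V" by blast
  then have "is_path V E [w]" by (simp add: is_path_def)
  then have "p \<in> path_length ` {xs. is_path V E xs}"
    unfolding p_def longest_path_length_def using paths by (intro Max_in) auto
  then obtain L where L: "is_path V E L" "p = path_length L" by auto
  have bound: "length xs \<le> p + 1" if "is_path V E xs" for xs
  proof -
    have "path_length xs \<le> p"
      unfolding p_def longest_path_length_def using paths that by (intro Max_ge) auto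
    then show ?thesis by (simp add: path_length_def)
  qed
  have kp: "k < p + 1"
  proof (rule ccontr)
    assume "\<not> k < p + 1"
    moreover have "length L = p + 1" using L by (cases L) (auto simp: path_length_def is_path_def)
    ultimately obtain z where "is_path V E (L @ [z])"
      using k_connected_extend_path[OF fin assms(3) L(1)] by auto
    then show False using bound[of "L @ [z]"] \<open>length L = p + 1\<close> by simp
  qed
  \<comment> \<open>A length of at least \<open>p - t + 1\<close> means at least
    \<open>(p + 1) - (t - 1)\<close> vertices, so the slack is \<open>t - 1\<close>;
    \<open>nat\<close> makes it 0 when \<open>t = 0\<close>.\<close>
  define n where "n = nat (t - 1)"
  have kn: "2 * n\<^sup>2 + 3 \<le> k"
  proof (cases "t \<le> 1")
    case True
    then show ?thesis using assms(2) by (simp add: n_def)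
  next
    case False
    define s where "s = sqrt ((real k - 2) / 2)"
    have s: "0 \<le> s" "s\<^sup>2 = (real k - 2) / 2" using assms(2) by (auto simp: s_def)
    \<comment> \<open>Floor and ceiling both stay below \<open>s + 1\<close>, so
      \<open>n < s\<close> in either parity, and squaring gives
      \<open>2 * n\<^sup>2 < k - 2\<close>.\<close>
    have "of_int t < s + 1"
    proof (cases "even p")
      case True
      then have "t = \<lfloor>s\<rfloor>" by (simp add: t_def s_def)
      then show ?thesis by linarith
    next
      case False
      then have "t = \<lceil>s\<rceil>" by (simp add: t_def s_def)
      then show ?thesis by linarith
    qed
    moreover have "real n = of_int t - 1" using False by (simp add: n_def)
    ultimately have "real n < s" by simp
    then have "(real n)\<^sup>2 < s\<^sup>2" by (intro power_strict_mono) auto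
    then have "real (2 * n\<^sup>2 + 2) < real k" unfolding s(2) by simp
    then show ?thesis by linarith
  qed
  interpret long_paths V E k "p + 1" n
  proof
    show "finite V" "k < p + 1" "2 * n\<^sup>2 + 3 \<le> k" by (fact fin, fact kp, fact kn)
    show "k < card V" using assms(3) by (simp add: k_connected_def)
    show "length xs \<le> p + 1" if "is_path V E xs" for xs using that by (rule bound)
    show "connected_graph (V - S) E" if "S \<subseteq> V" "card S < k" for S
      using assms(3) that connected_del_verts[of V S E] by (simp add: k_connected_def)
  qed
  obtain F where F: "is_bond V E F"
    "\<And>xs. is_path V E xs \<Longrightarrow> p + 1 \<le> length xs + n \<Longrightarrow> path_edges xs \<inter> F \<noteq> {}"
    using bond_meeting_long_paths by blast
  have "p + 1 \<le> length xs + n" if "is_path V E xs" "int (path_length xs) \<ge> int p - t + 1" for xs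
  proof -
    have "0 < length xs" using that by (simp add: is_path_def)
    then have "int (path_length xs) = int (length xs) - 1" unfolding path_length_def by linarith
    then show ?thesis using that(2) unfolding n_def by linarith
  qed
  with F show ?thesis by (intro exI[of _ F]) auto
qed

end
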